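(* Let $\mathcal C\subseteq 2^{[n]}$ and $\mathcal D$ be codes. If $[\mathcal C]$ covers $[\mathcal D]$ in $\mathbf{P}_{\mathbf{Code}}$, then either (i) $\mathcal D$ is isomorphic to a simple trunk $\mathrm{Tk}_{\mathcal C}(j)$ of $\mathcal C$ for some $j$, or (ii) $\mathcal D$ is isomorphic to $\mathcal C^{(i)}$ for some $i\in[n]$.
   Context: A code is a subset $\mathcal C\subseteq 2^{[n]}$. For $\sigma\subseteq[n]$, $\mathrm{Tk}_{\mathcal C}(\sigma)=\{c\in\mathcal C\mid\sigma\subseteq c\}$, and the simple trunks are $T_j=\mathrm{Tk}_{\mathcal C}(j)=\mathrm{Tk}_{\mathcal C}(\{j\})$. A trunk in $\mathcal C$ is a subset that is empty or equal to some $\mathrm{Tk}_{\mathcal C}(\sigma)$. A morphism between codes $\mathcal C\subseteq 2^{[n]}$, $\mathcal D\subseteq 2^{[m]}$ is a function $f:\mathcal C\to\mathcal D$ such that the preimage of every trunk in $\mathcal D$ is a trunk in $\mathcal C$; an isomorphism is a bijective morphism whose inverse is a morphism. Given trunks $S_1,\ldots,S_m$ in $\mathcal C$, the morphism determined by them is $c\mapsto\{j\in[m]\mid c\in S_j\}$. The $i$-th covered code $\mathcal C^{(i)}$ is the image of $\mathcal C$ under the morphism determined by the collection $\{T_j\mid j\neq i\}\cup\{T_j\cap T_i\mid j\neq i,\ T_j\cap T_i\neq T_i\}$. An operation on a code replaces it by one of its trunks (as a code) or by its image under a morphism. For isomorphism classes, $[\mathcal C]\le[\mathcal D]$ if a finite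 sequence of operations takes $\mathcal D$ to a code isomorphic to $\mathcal C$; this gives the poset $\mathbf{P}_{\mathbf{Code}}$. $[\mathcal C]$ covers $[\mathcal D]$ if $[\mathcal D]<[\mathcal C]$ with nothing strictly in between.
   Formalization: Two conditions are added because the claim fails without them: distinct i, j in [n] never have equal nonempty simple trunks T_i = T_j (e.g. {∅,12,34,1234} is a counterexample), and the pair C = {[n]}, D = ∅ is excluded. *)

theory Defs
  imports Main
begin

text \<open>
  A code is a subset of the power set of \<open>[n] = {1..n}\<close>.  It is represented together with the
  number \<open>n\<close> of its neurons, because the same set of codewords can be viewed as a subset of
  \<open>2\<^sup>[n]\<close> for different \<open>n\<close>.
\<close>

type_synonym code = "nat \<times> nat set set"

definition codes :: "code set" where
  "codes = {(n, C). C \<subseteq> Pow {1..n}}"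

definition Tk :: "nat set set \<Rightarrow> nat set \<Rightarrow> nat set set" where
  "Tk C \<sigma> = {c \<in> C. \<sigma> \<subseteq> c}"

abbreviation simple_trunk :: "nat set set \<Rightarrow> nat \<Rightarrow> nat set set" where
  "simple_trunk C j \<equiv> Tk C {j}"

definition trunks :: "code \<Rightarrow> nat set set set" where
  "trunks = (\<lambda>(n, C). {S. S = {} \<or> (\<exists>\<sigma>. \<sigma> \<subseteq> {1..n} \<and> S = Tk C \<sigma>)})"

definition morphism :: "code \<Rightarrow> code \<Rightarrow> (nat set \<Rightarrow> nat set) \<Rightarrow> bool" where
  "morphism X Y f \<longleftrightarrow>
     f ` snd X \<subseteq> snd Y \<and> (\<forall>S \<in> trunks Y. {c \<in> snd X. f c \<in> S} \<in> trunks X)"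

definition isomorphism :: "code \<Rightarrow> code \<Rightarrow> (nat set \<Rightarrow> nat set) \<Rightarrow> bool" where
  "isomorphism X Y f \<longleftrightarrow>
     morphism X Y f \<and> bij_betw f (snd X) (snd Y) \<and> morphism Y X (inv_into (snd X) f)"

definition isomorphic :: "code \<Rightarrow> code \<Rightarrow> bool" where
  "isomorphic X Y \<longleftrightarrow> (\<exists>f. isomorphism X Y f)"

text \<open>
  The trunks \<open>S\<^sub>1, \<dots>, S\<^sub>m\<close> are given as a list; list positions start at \<open>0\<close>, neurons at \<open>1\<close>.
  Reordering or repeating trunks in the list changes the image code only up to isomorphism.
\<close>

definition determined_morphism :: "nat set set list \<Rightarrow> nat set \<Rightarrow> nat set" where
  "determined_morphism Ss c = {j \<in> {1..length Ss}. c \<in> Ss ! (j - 1)}"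

definition covered_code_trunks :: "nat \<Rightarrow> nat set set \<Rightarrow> nat \<Rightarrow> nat set set list" where
  "covered_code_trunks n C i =
     [simple_trunk C j. j \<leftarrow> [1..<Suc n], j \<noteq> i] @
     [simple_trunk C j \<inter> simple_trunk C i. j \<leftarrow> [1..<Suc n],
        j \<noteq> i \<and> simple_trunk C j \<inter> simple_trunk C i \<noteq> simple_trunk C i]"

definition covered_code :: "nat \<Rightarrow> nat set set \<Rightarrow> nat \<Rightarrow> code" where
  "covered_code n C i =
     (length (covered_code_trunks n C i),
      determined_morphism (covered_code_trunks n C i) ` C)"

inductive operation :: "code \<Rightarrow> code \<Rightarrow> bool" where
  trunk: "S \<in> trunks (n, C) \<Longrightarrow> operation (n, C) (n, S)"
| image: "(m, D) \<in> codes \<Longrightarrow> morphism (n, C) (m, D) f \<Longrightarrow> operation (n, C) (m, f ` C)"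

definition iso_rel :: "code rel" where
  "iso_rel = {(X, Y). X \<in> codes \<and> Y \<in> codes \<and> isomorphic X Y}"

definition iso_class :: "code \<Rightarrow> code set" where
  "iso_class X = iso_rel `` {X}"

definition P_Code :: "code set set" where
  "P_Code = codes // iso_rel"

text \<open>
  The order does not depend on the representatives; see \<open>P_Code_le_iso_class\<close> below.
\<close>

definition P_Code_le :: "code set \<Rightarrow> code set \<Rightarrow> bool" where
  "P_Code_le A B \<longleftrightarrow> (\<exists>X \<in> A. \<exists>Y \<in> B. \<exists>Z. operation\<^sup>*\<^sup>* Y Z \<and> isomorphic Z X)"

definition P_Code_less :: "code set \<Rightarrow> code set \<Rightarrow> bool" where
  "P_Code_less A B \<longleftrightarrow> P_Code_le A B \<and> A \<noteq> B"

definition P_Code_covers :: "code set \<Rightarrow> code set \<Rightarrow> bool" where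
  "P_Code_covers A B \<longleftrightarrow>
     P_Code_less B A \<and> \<not> (\<exists>E \<in> P_Code. P_Code_less B E \<and> P_Code_less E A)"

lemma morphism_id: "morphism X X id"
  by (cases X) (auto simp: morphism_def trunks_def Tk_def)

lemma morphism_cong:
  assumes "morphism X Y f" "\<And>c. c \<in> snd X \<Longrightarrow> f c = g c"
  shows "morphism X Y g"
proof -
  have "{c \<in> snd X. g c \<in> S} = {c \<in> snd X. f c \<in> S}" for S
    using assms(2) by auto
  moreover have "g ` snd X = f ` snd X"
    using assms(2) by auto
  ultimately show ?thesis
    using assms(1) by (simp add: morphism_def)
qed

lemma morphism_comp:
  assumes "morphism X Y f" "morphism Y Z g"
  shows "morphism X Z (g \<circ> f)"
  unfolding morphism_def
proof (intro conjI ballI)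
  show "(g \<circ> f) ` snd X \<subseteq> snd Z"
    using assms by (fastforce simp: morphism_def)
next
  fix S assume "S \<in> trunks Z"
  hence "{c \<in> snd Y. g c \<in> S} \<in> trunks Y"
    using assms(2) by (simp add: morphism_def)
  hence "{c \<in> snd X. f c \<in> {c \<in> snd Y. g c \<in> S}} \<in> trunks X"
    using assms(1) unfolding morphism_def by blast
  moreover have "{c \<in> snd X. f c \<in> {c \<in> snd Y. g c \<in> S}} = {c \<in> snd X. (g \<circ> f) c \<in> S}"
    using assms(1) unfolding morphism_def by auto
  ultimately show "{c \<in> snd X. (g \<circ> f) c \<in> S} \<in> trunks X"
    by simp
qed

lemma isomorphic_iff:
  "isomorphic X Y \<longleftrightarrow>
     (\<exists>f g. morphism X Y f \<and> morphism Y X g \<and>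
        (\<forall>c \<in> snd X. g (f c) = c) \<and> (\<forall>d \<in> snd Y. f (g d) = d))"
proof
  assume "isomorphic X Y"
  then obtain f where f: "morphism X Y f" "bij_betw f (snd X) (snd Y)"
    "morphism Y X (inv_into (snd X) f)"
    by (auto simp: isomorphic_def isomorphism_def)
  show "\<exists>f g. morphism X Y f \<and> morphism Y X g \<and>
        (\<forall>c \<in> snd X. g (f c) = c) \<and> (\<forall>d \<in> snd Y. f (g d) = d)"
    by (rule exI[of _ f], rule exI[of _ "inv_into (snd X) f"])
      (use f in \<open>auto simp: bij_betw_inv_into_left bij_betw_inv_into_right\<close>)
next
  assume "\<exists>f g. morphism X Y f \<and> morphism Y X g \<and>
        (\<forall>c \<in> snd X. g (f c) = c) \<and> (\<forall>d \<in> snd Y. f (g d) = d)"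
  then obtain f g where fg: "morphism X Y f" "morphism Y X g"
    "\<forall>c \<in> snd X. g (f c) = c" "\<forall>d \<in> snd Y. f (g d) = d" by blast
  have sub: "f ` snd X \<subseteq> snd Y" "g ` snd Y \<subseteq> snd X"
    using fg by (simp_all add: morphism_def)
  have bij: "bij_betw f (snd X) (snd Y)"
    by (rule bij_betw_byWitness[where f' = g]) (use fg sub in auto)
  have "inv_into (snd X) f d = g d" if "d \<in> snd Y" for d
  proof -
    have "g d \<in> snd X" using sub that by blast
    thus ?thesis
      using bij_betw_inv_into_left[OF bij, of "g d"] fg(4) that by simp
  qed
  hence "morphism Y X (inv_into (snd X) f)"
    by (intro morphism_cong[OF fg(2)]) simp
  thus "isomorphic X Y"
    using fg bij by (auto simp: isomorphic_def isomorphism_def)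
qed

lemma isomorphic_refl: "isomorphic X X"
  unfolding isomorphic_iff using morphism_id[of X] by fastforce

lemma isomorphic_sym: "isomorphic X Y \<Longrightarrow> isomorphic Y X"
  unfolding isomorphic_iff by blast

lemma isomorphic_trans:
  assumes "isomorphic X Y" "isomorphic Y Z"
  shows "isomorphic X Z"
proof -
  obtain f g where fg: "morphism X Y f" "morphism Y X g"
    "\<forall>c \<in> snd X. g (f c) = c" "\<forall>d \<in> snd Y. f (g d) = d"
    using assms(1) unfolding isomorphic_iff by blast
  obtain h k where hk: "morphism Y Z h" "morphism Z Y k"
    "\<forall>c \<in> snd Y. k (h c) = c" "\<forall>d \<in> snd Z. h (k d) = d"
    using assms(2) unfolding isomorphic_iff by blast
  have sub: "f ` snd X \<subseteq> snd Y" "k ` snd Z \<subseteq> snd Y"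
    using fg hk by (simp_all add: morphism_def)
  have "\<forall>c \<in> snd X. (g \<circ> k) ((h \<circ> f) c) = c" "\<forall>d \<in> snd Z. (h \<circ> f) ((g \<circ> k) d) = d"
    using fg hk sub by (auto simp: image_subset_iff)
  thus ?thesis
    unfolding isomorphic_iff
    using morphism_comp[OF fg(1) hk(1)] morphism_comp[OF hk(2) fg(2)] by blast
qed

lemma equiv_iso_rel: "equiv codes iso_rel"
proof (rule equivI)
  show "iso_rel \<subseteq> codes \<times> codes"
    by (auto simp: iso_rel_def)
  show "refl_on codes iso_rel"
    by (auto simp: refl_on_def iso_rel_def isomorphic_refl)
  show "sym iso_rel"
    by (auto simp: sym_def iso_rel_def intro: isomorphic_sym)
  show "trans iso_rel"
    by (rule transI) (auto simp: iso_rel_def intro: isomorphic_trans)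
qed

lemma iso_class_eq_iff:
  "X \<in> codes \<Longrightarrow> Y \<in> codes \<Longrightarrow> iso_class X = iso_class Y \<longleftrightarrow> isomorphic X Y"
  unfolding iso_class_def
  using eq_equiv_class_iff[OF equiv_iso_rel] by (simp add: iso_rel_def)

lemma operation_of_isomorphic:
  assumes "X \<in> codes" "isomorphic Y X"
  shows "operation Y X"
proof -
  obtain n C m D where XY: "Y = (n, C)" "X = (m, D)" by fastforce
  obtain f where "morphism Y X f" "bij_betw f C D"
    using assms(2) by (auto simp: isomorphic_def isomorphism_def XY)
  thus ?thesis
    using operation.image[of m D n C f] assms(1) by (simp add: XY bij_betw_def)
qed

lemma P_Code_le_iso_class:
  assumes "X \<in> codes" "Y \<in> codes"
  shows "P_Code_le (iso_class X) (iso_class Y) \<longleftrightarrow>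
           (\<exists>Z. operation\<^sup>*\<^sup>* Y Z \<and> isomorphic Z X)"
proof
  assume "P_Code_le (iso_class X) (iso_class Y)"
  then obtain X' Y' Z where *: "isomorphic X X'" "isomorphic Y Y'" "Y' \<in> codes"
    "operation\<^sup>*\<^sup>* Y' Z" "isomorphic Z X'"
    by (auto simp: P_Code_le_def iso_class_def iso_rel_def)
  have "operation\<^sup>*\<^sup>* Y Z"
    using operation_of_isomorphic[OF *(3,2)] *(4) by (rule converse_rtranclp_into_rtranclp)
  moreover have "isomorphic Z X"
    using * isomorphic_sym isomorphic_trans by blast
  ultimately show "\<exists>Z. operation\<^sup>*\<^sup>* Y Z \<and> isomorphic Z X" by blast
next
  assume "\<exists>Z. operation\<^sup>*\<^sup>* Y Z \<and> isomorphic Z X"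
  moreover have "X \<in> iso_class X" "Y \<in> iso_class Y"
    using assms by (simp_all add: iso_class_def iso_rel_def isomorphic_refl)
  ultimately show "P_Code_le (iso_class X) (iso_class Y)"
    unfolding P_Code_le_def by blast
qed

end

theory Submission
  imports Defs
begin

text \<open>
  A code below \<open>C\<close> is the image of a trunk \<open>S\<close> of \<open>C\<close> under a morphism.  If \<open>S \<noteq> C\<close> then \<open>S\<close> lies in
  a proper simple trunk, which sits strictly below \<open>C\<close> and hence is \<open>D\<close>.  If \<open>S = C\<close>, the morphism
  \<open>f: C \<rightarrow> D\<close> is not an isomorphism, so some simple trunk \<open>T\<^sub>i\<close> is not the preimage of a trunk; choose
  one that is maximal under inclusion.  The map \<open>C \<rightarrow> C\<^sup>(\<^sup>i\<^sup>)\<close> realises all trunks of \<open>C\<close> except \<open>T\<^sub>i\<close> as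
  preimages: \<open>T\<^sub>i\<close> itself would have to be an intersection of strictly larger simple trunks, which
  by maximality are preimages under \<open>f\<close>.  Hence \<open>f\<close> factors through \<open>C\<^sup>(\<^sup>i\<^sup>)\<close>, and \<open>C\<^sup>(\<^sup>i\<^sup>)\<close> has fewer
  trunks than \<open>C\<close>.
\<close>

section \<open>Trunks: intersections, finiteness and passage to subcodes\<close>

lemma empty_in_trunks: "{} \<in> trunks X"
  by (cases X) (simp add: trunks_def)

lemma Tk_in_trunks: "\<sigma> \<subseteq> {1..n} \<Longrightarrow> Tk C \<sigma> \<in> trunks (n, C)"
  by (auto simp: trunks_def)

lemma trunks_cases:
  assumes "S \<in> trunks (n, C)"
  obtains "S = {}" | \<sigma> where "\<sigma> \<subseteq> {1..n}" "S = Tk C \<sigma>"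
  using assms by (auto simp: trunks_def)

lemma simple_trunk_in_trunks: "j \<in> {1..n} \<Longrightarrow> simple_trunk C j \<in> trunks (n, C)"
  by (rule Tk_in_trunks) simp

lemma trunks_subset: "S \<in> trunks X \<Longrightarrow> S \<subseteq> snd X"
  by (cases X) (auto simp: trunks_def Tk_def)

lemma whole_in_trunks: "snd X \<in> trunks X"
  by (cases X) (auto simp: trunks_def Tk_def)

lemma Tk_Un: "Tk C (\<sigma> \<union> \<tau>) = Tk C \<sigma> \<inter> Tk C \<tau>"
  by (auto simp: Tk_def)

lemma Int_in_trunks:
  assumes "S \<in> trunks X" "T \<in> trunks X"
  shows "S \<inter> T \<in> trunks X"
proof (cases X)
  case (Pair n C)
  from assms show ?thesis
    unfolding Pair
    by (elim trunks_cases) (auto simp: empty_in_trunks Tk_Un[symmetric] intro!: Tk_in_trunks)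
qed

lemma finite_codeword_set: "(n, C) \<in> codes \<Longrightarrow> finite C"
  unfolding codes_def by (simp add: finite_subset[of C "Pow {1..n}"])

lemma finite_trunks:
  assumes "X \<in> codes"
  shows "finite (trunks X)"
proof -
  have "finite (snd X)"
    using assms finite_codeword_set[of "fst X" "snd X"] by simp
  thus ?thesis
    using trunks_subset[of _ X] by (meson Pow_iff finite_Pow_iff finite_subset subsetI)
qed

lemma trunk_in_codes: "(n, C) \<in> codes \<Longrightarrow> S \<in> trunks (n, C) \<Longrightarrow> (n, S) \<in> codes"
  using trunks_subset[of S "(n, C)"] by (auto simp: codes_def)

text \<open>A trunk of \<open>S\<close> is \<open>S\<close> intersected with a trunk of
  \<open>C\<close>, and trunks are closed under intersection. Hence successive trunk operations
  merge into one.\<close>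

lemma trunks_of_trunk:
  assumes "S \<in> trunks (n, C)"
  shows "trunks (n, S) \<subseteq> trunks (n, C)"
proof
  fix T assume "T \<in> trunks (n, S)"
  thus "T \<in> trunks (n, C)"
  proof (cases rule: trunks_cases)
    case 1
    thus ?thesis by (simp add: empty_in_trunks)
  next
    case (2 \<sigma>)
    have "T = S \<inter> Tk C \<sigma>"
      using 2 trunks_subset[OF assms] by (auto simp: Tk_def)
    thus ?thesis using Int_in_trunks[OF assms Tk_in_trunks[OF 2(1)]] by simp
  qed
qed

lemma Int_trunk_in_trunks:
  assumes "T \<in> trunks (n, C)" "S \<subseteq> C"
  shows "T \<inter> S \<in> trunks (n, S)"
  using assms(1)
proof (cases rule: trunks_cases)
  case 1
  thus ?thesis by (simp add: empty_in_trunks)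
next
  case (2 \<sigma>)
  have "T \<inter> S = Tk S \<sigma>"
    using 2 assms(2) by (auto simp: Tk_def)
  thus ?thesis using Tk_in_trunks[OF 2(1)] by simp
qed

section \<open>Sequences of operations reduced to one trunk and one morphism\<close>

lemma morphism_restrict:
  assumes f: "morphism (n, C) (m, D) f" and "S \<subseteq> C" "f ` S \<subseteq> E" "E \<subseteq> D"
    and E: "trunks (m, E) \<subseteq> trunks (m, D)"
  shows "morphism (n, S) (m, E) f"
  unfolding morphism_def
proof (intro conjI ballI)
  show "f ` snd (n, S) \<subseteq> snd (m, E)" using assms by simp
next
  fix T assume "T \<in> trunks (m, E)"
  hence "{c \<in> C. f c \<in> T} \<in> trunks (n, C)"
    using f E by (auto simp: morphism_def)
  moreover have "{c \<in> snd (n, S). f c \<in> T} = {c \<in> C. f c \<in> T} \<inter> S"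
    using assms(2) by auto
  ultimately show "{c \<in> snd (n, S). f c \<in> T} \<in> trunks (n, S)"
    using Int_trunk_in_trunks[OF _ assms(2)] by simp
qed

text \<open>For each \<sigma>, the trunks of \<sigma> in \<open>D\<close> and in the image of
  \<open>f\<close> have the same preimage, because \<open>f\<close> takes values only in its image.
  So an image operation can be read as a surjective morphism.\<close>

lemma morphism_onto_image:
  assumes "morphism (n, C) (m, D) f"
  shows "morphism (n, C) (m, f ` C) f"
  unfolding morphism_def
proof (intro conjI ballI)
  fix T assume "T \<in> trunks (m, f ` C)"
  thus "{c \<in> snd (n, C). f c \<in> T} \<in> trunks (n, C)"
  proof (cases rule: trunks_cases)
    case 1
    thus ?thesis by (simp add: empty_in_trunks)
  next
    case (2 \<sigma>)
    have "{c \<in> snd (n, C). f c \<in> T} = {c \<in> snd (n, C). f c \<in> Tk D \<sigma>}"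
      using 2 assms by (auto simp: Tk_def morphism_def)
    thus ?thesis using assms Tk_in_trunks[OF 2(1)] by (simp add: morphism_def)
  qed
qed simp

text \<open>Trunk operations move to the front: a trunk \<open>T\<close> of the image pulls back
  along \<open>f\<close> to a trunk of \<open>S\<close>, which is again a trunk of \<open>C\<close>.
  Image operations merge by composition.\<close>

lemma operations_trunk_image:
  assumes "operation\<^sup>*\<^sup>* (n, C) Z"
  shows "\<exists>S \<in> trunks (n, C). \<exists>f. morphism (n, S) Z f \<and> f ` S = snd Z"
  using assms
proof (induction rule: rtranclp_induct)
  case base
  show ?case
    using whole_in_trunks[of "(n, C)"] morphism_id[of "(n, C)"] image_id
    by (metis id_apply snd_conv)
next
  case (step Y Z)
  then obtain S f where S: "S \<in> trunks (n, C)" and f: "morphism (n, S) Y f" "f ` S = snd Y"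
    by blast
  from \<open>operation Y Z\<close> show ?case
  proof cases
    case (trunk T k E)
    define S' where "S' = {c \<in> S. f c \<in> T}"
    have "S' \<in> trunks (n, S)"
      using f trunk by (simp add: morphism_def S'_def)
    hence "S' \<in> trunks (n, C)"
      using trunks_of_trunk[OF S] by blast
    moreover have "morphism (n, S') (k, T) f"
    proof (rule morphism_restrict[of _ S _ E])
      show "trunks (k, T) \<subseteq> trunks (k, E)"
        using trunk by (intro trunks_of_trunk)
      show "T \<subseteq> E" using trunks_subset[of T "(k, E)"] trunk by simp
    qed (use f trunk in \<open>auto simp: S'_def\<close>)
    moreover have "f ` S' = T"
      using f trunk trunks_subset[of T "(k, E)"] by (auto simp: S'_def)
    ultimately show ?thesis using trunk by auto
  next
    case (image k E l B g)
    have "morphism (n, S) Z (g \<circ> f)"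
      using morphism_comp[OF f(1)] morphism_onto_image image by blast
    moreover have "(g \<circ> f) ` S = snd Z"
      using f(2) image by (simp only: image_comp[symmetric] snd_conv)
    ultimately show ?thesis using S by blast
  qed
qed

lemma P_Code_le_trunk_image:
  assumes "(n, C) \<in> codes" "Y \<in> codes"
  shows "P_Code_le (iso_class Y) (iso_class (n, C)) \<longleftrightarrow>
    (\<exists>S \<in> trunks (n, C). \<exists>f. morphism (n, S) Y f \<and> f ` S = snd Y)" (is "?L \<longleftrightarrow> ?R")
proof
  assume ?L
  then obtain Z where Z: "operation\<^sup>*\<^sup>* (n, C) Z" "isomorphic Z Y"
    using P_Code_le_iso_class assms by blast
  obtain S f where S: "S \<in> trunks (n, C)" and f: "morphism (n, S) Z f" "f ` S = snd Z"
    using operations_trunk_image[OF Z(1)] by blast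
  obtain g where g: "morphism Z Y g" "bij_betw g (snd Z) (snd Y)"
    using Z(2) by (auto simp: isomorphic_def isomorphism_def)
  have "(g \<circ> f) ` S = snd Y"
    using f(2) bij_betw_imp_surj_on[OF g(2)] by (simp only: image_comp[symmetric])
  thus ?R using S morphism_comp[OF f(1) g(1)] by blast
next
  assume ?R
  then obtain S f where S: "S \<in> trunks (n, C)" and f: "morphism (n, S) Y f" "f ` S = snd Y"
    by blast
  have "operation (n, C) (n, S)" using S by (rule operation.trunk)
  moreover have "operation (n, S) Y"
    using operation.image[of "fst Y" "snd Y" n S f] assms f by simp
  ultimately have "operation\<^sup>*\<^sup>* (n, C) Y" by auto
  thus ?L using P_Code_le_iso_class assms isomorphic_refl by blast
qed

lemma P_Code_le_image:
  assumes "X \<in> codes" "Y \<in> codes" "morphism X Y f" "f ` snd X = snd Y"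
  shows "P_Code_le (iso_class Y) (iso_class X)"
proof (cases X)
  case (Pair n C)
  show ?thesis
    unfolding Pair P_Code_le_trunk_image[OF assms(1)[unfolded Pair] assms(2)]
    using whole_in_trunks[of X] assms(3,4) unfolding Pair snd_conv by blast
qed

text \<open>How covering is exploited: it suffices to exhibit a code between the two and to rule out
  that it is the upper one.\<close>

lemma P_Code_covers_sandwich:
  assumes "P_Code_covers (iso_class X) (iso_class Y)" "X \<in> codes" "Y \<in> codes" "E \<in> codes"
    and "P_Code_le (iso_class Y) (iso_class E)" "P_Code_le (iso_class E) (iso_class X)"
    and "\<not> isomorphic E X"
  shows "isomorphic Y E"
proof -
  have "iso_class E \<in> P_Code"
    using assms(4) by (simp add: P_Code_def iso_class_def quotientI)
  thus ?thesis
    using assms iso_class_eq_iff unfolding P_Code_covers_def P_Code_less_def by blast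
qed

lemma isomorphic_card_eq: "isomorphic X Y \<Longrightarrow> card (snd X) = card (snd Y)"
  by (auto simp: isomorphic_def isomorphism_def dest: bij_betw_same_card)

section \<open>Pulled-back trunks and factorisation of morphisms\<close>

text \<open>For a surjective morphism this family acts like the kernel of a quotient map: by
  \<open>morphism_factor\<close> it determines the target up to isomorphism.\<close>

definition preimage_trunks :: "code \<Rightarrow> code \<Rightarrow> (nat set \<Rightarrow> nat set) \<Rightarrow> nat set set set" where
  "preimage_trunks X Y f = (\<lambda>S. {c \<in> snd X. f c \<in> S}) ` trunks Y"

lemma preimage_trunksI: "S \<in> trunks Y \<Longrightarrow> {c \<in> snd X. f c \<in> S} \<in> preimage_trunks X Y f"
  by (auto simp: preimage_trunks_def)

lemma morphism_iff_preimage_trunks: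
  "morphism X Y f \<longleftrightarrow> f ` snd X \<subseteq> snd Y \<and> preimage_trunks X Y f \<subseteq> trunks X"
  by (auto simp: morphism_def preimage_trunks_def)

lemma empty_in_preimage_trunks: "{} \<in> preimage_trunks X Y f"
  using preimage_trunksI[OF empty_in_trunks, of X f Y] by simp

lemma whole_in_preimage_trunks:
  assumes "f ` snd X \<subseteq> snd Y"
  shows "snd X \<in> preimage_trunks X Y f"
proof -
  have "{c \<in> snd X. f c \<in> snd Y} = snd X" using assms by auto
  thus ?thesis using preimage_trunksI[OF whole_in_trunks, of X f Y] by simp
qed

lemma Int_in_preimage_trunks:
  assumes "S \<in> preimage_trunks X Y f" "T \<in> preimage_trunks X Y f"
  shows "S \<inter> T \<in> preimage_trunks X Y f"
proof -
  obtain S' T' where *: "S' \<in> trunks Y" "T' \<in> trunks Y"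
    "S = {c \<in> snd X. f c \<in> S'}" "T = {c \<in> snd X. f c \<in> T'}"
    using assms by (auto simp: preimage_trunks_def)
  have "S \<inter> T = {c \<in> snd X. f c \<in> S' \<inter> T'}" using * by auto
  thus ?thesis using preimage_trunksI[OF Int_in_trunks[OF *(1,2)]] by simp
qed

text \<open>The intersection is taken inside \<open>C\<close> so that an empty index set gives
  \<open>C\<close>, just as \<open>Tk C {}\<close> does. \<open>F\<close> will be either the trunks
  or the pulled-back trunks.\<close>

lemma finite_Inter_in_family:
  assumes "C \<in> F" "\<And>S T. S \<in> F \<Longrightarrow> T \<in> F \<Longrightarrow> S \<inter> T \<in> F"
    and "finite I" "\<And>i. i \<in> I \<Longrightarrow> A i \<in> F"
  shows "{c \<in> C. \<forall>i \<in> I. c \<in> A i} \<in> F"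
  using assms(3,4)
proof (induction I rule: finite_induct)
  case empty
  thus ?case using assms(1) by simp
next
  case (insert i I)
  have "{c \<in> C. \<forall>j \<in> insert i I. c \<in> A j} = A i \<inter> {c \<in> C. \<forall>j \<in> I. c \<in> A j}"
    by auto
  thus ?case using insert assms(2) by simp
qed

lemma Tk_conv_simple_trunks: "Tk C \<sigma> = {c \<in> C. \<forall>j \<in> \<sigma>. c \<in> simple_trunk C j}"
  by (auto simp: Tk_def)

text \<open>Simple trunks suffice as a test, since every nonempty trunk is a finite intersection of
  them and the pulled-back family is closed under intersection.\<close>

lemma trunks_in_preimage_trunks:
  assumes "f ` C \<subseteq> snd Y" "\<And>i. i \<in> {1..n} \<Longrightarrow> simple_trunk C i \<in> preimage_trunks (n, C) Y f"
  shows "trunks (n, C) \<subseteq> preimage_trunks (n, C) Y f"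
proof
  fix S assume "S \<in> trunks (n, C)"
  thus "S \<in> preimage_trunks (n, C) Y f"
  proof (cases rule: trunks_cases)
    case 1
    thus ?thesis by (simp add: empty_in_preimage_trunks)
  next
    case (2 \<sigma>)
    have "finite \<sigma>" using 2(1) finite_subset by blast
    thus ?thesis
      unfolding 2(2) Tk_conv_simple_trunks[of C \<sigma>]
      using 2(1) assms whole_in_preimage_trunks[of f "(n, C)" Y]
      by (intro finite_Inter_in_family) (auto intro: Int_in_preimage_trunks)
  qed
qed

text \<open>Trunks separate codewords, so the inclusion of families forces \<open>f\<close> to be
  constant on the fibres of \<open>g\<close>; \<open>h\<close> is the induced map.\<close>

lemma morphism_factor:
  assumes "Z \<in> codes" and f: "morphism X Z f" and g: "morphism X Y g" "g ` snd X = snd Y"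
    and sub: "preimage_trunks X Z f \<subseteq> preimage_trunks X Y g"
  obtains h where "morphism Y Z h" "\<And>c. c \<in> snd X \<Longrightarrow> h (g c) = f c"
proof -
  \<comment> \<open>The trunk of \<open>f c\<close> consists of the codewords containing
    \<open>f c\<close>. Its preimage under \<open>f\<close> is also a preimage under
    \<open>g\<close>, so it contains \<open>c'\<close> along with \<open>c\<close>. Exchanging the
    two gives equality.\<close>
  have le: "f c \<subseteq> f c'" if c: "c \<in> snd X" "c' \<in> snd X" "g c = g c'" for c c'
  proof -
    have fc: "f c \<in> snd Z" using f c by (auto simp: morphism_def)
    hence "f c \<subseteq> {1..fst Z}" using assms(1) unfolding codes_def by fastforce
    hence "Tk (snd Z) (f c) \<in> trunks Z" using Tk_in_trunks[of "f c" "fst Z" "snd Z"] by simp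
    then obtain S where "{d \<in> snd X. f d \<in> Tk (snd Z) (f c)} = {d \<in> snd X. g d \<in> S}"
      using sub preimage_trunksI[OF \<open>Tk (snd Z) (f c) \<in> trunks Z\<close>, of X f]
      by (auto simp: preimage_trunks_def)
    moreover have "c \<in> {d \<in> snd X. f d \<in> Tk (snd Z) (f c)}"
      using c fc by (simp add: Tk_def)
    ultimately have "c' \<in> {d \<in> snd X. f d \<in> Tk (snd Z) (f c)}"
      using c by simp
    thus ?thesis by (simp add: Tk_def)
  qed
  define h where "h = f \<circ> inv_into (snd X) g"
  have hg: "h (g c) = f c" if "c \<in> snd X" for c
  proof -
    have "inv_into (snd X) g (g c) \<in> snd X" "g (inv_into (snd X) g (g c)) = g c"
      using that inv_into_into[of "g c" g "snd X"] f_inv_into_f[of "g c" g "snd X"] by blast+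
    thus ?thesis
      using le[of c "inv_into (snd X) g (g c)"] le[of "inv_into (snd X) g (g c)" c] that
      by (simp add: h_def)
  qed
  have "morphism Y Z h"
    unfolding morphism_def
  proof (intro conjI ballI)
    show "h ` snd Y \<subseteq> snd Z"
      using f hg g(2)[symmetric] by (auto simp: morphism_def)
  next
    fix S assume "S \<in> trunks Z"
    then obtain T where T: "T \<in> trunks Y" "{c \<in> snd X. f c \<in> S} = {c \<in> snd X. g c \<in> T}"
      using sub preimage_trunksI[of S Z X f] by (auto simp: preimage_trunks_def)
    \<comment> \<open>By surjectivity of \<open>g\<close>, both sides are images under
      \<open>g\<close> of the two equal preimages in \<open>X\<close>.\<close>
    have "{d \<in> snd Y. h d \<in> S} = T"
    proof -
      have "{d \<in> snd Y. h d \<in> S} = g ` {c \<in> snd X. f c \<in> S}"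
        using hg g(2)[symmetric] by auto
      also have "\<dots> = T"
        using T(2) trunks_subset[OF T(1)] g(2)[symmetric] by auto
      finally show ?thesis .
    qed
    thus "{d \<in> snd Y. h d \<in> S} \<in> trunks Y" using T by simp
  qed
  thus ?thesis using hg that by blast
qed

text \<open>Factoring \<open>id\<close> through \<open>f\<close> yields the inverse
  morphism.\<close>

lemma isomorphic_if_trunks_preimages:
  assumes "X \<in> codes" "morphism X Y f" "f ` snd X = snd Y" "trunks X \<subseteq> preimage_trunks X Y f"
  shows "isomorphic X Y"
proof -
  have "preimage_trunks X X id \<subseteq> preimage_trunks X Y f"
    using assms(4) morphism_id[of X] by (auto simp: morphism_iff_preimage_trunks)
  then obtain h where h: "morphism Y X h" "\<And>c. c \<in> snd X \<Longrightarrow> h (f c) = id c"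
    using morphism_factor[OF assms(1) morphism_id assms(2,3)] by blast
  have "\<forall>d \<in> snd Y. f (h d) = d"
    using h(2) assms(3)[symmetric] by auto
  moreover have "\<forall>c \<in> snd X. h (f c) = c" using h(2) by simp
  ultimately show ?thesis unfolding isomorphic_iff using assms(2) h(1) by blast
qed

text \<open>Under a surjection a trunk is the image of its own preimage, so pulling back is
  injective.\<close>

lemma card_preimage_trunks:
  assumes "f ` snd X = snd Y"
  shows "card (preimage_trunks X Y f) = card (trunks Y)"
  unfolding preimage_trunks_def
proof (rule card_image, rule inj_on_inverseI)
  fix S assume "S \<in> trunks Y"
  hence "S \<subseteq> f ` snd X" using trunks_subset assms by simp
  thus "f ` {c \<in> snd X. f c \<in> S} = S" by auto
qed

text \<open>The given isomorphism may be unrelated to \<open>f\<close>, so the argument counts: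
  \<open>X\<close> has no more trunks than \<open>Y\<close>, hence no more than the pulled-back
  family, which already lies inside the finite set \<open>trunks X\<close>.\<close>

lemma isomorphic_imp_trunks_eq_preimages:
  assumes "X \<in> codes" "Y \<in> codes" "isomorphic Y X" "morphism X Y f" "f ` snd X = snd Y"
  shows "preimage_trunks X Y f = trunks X"
proof (rule card_seteq)
  show "finite (trunks X)" using finite_trunks assms by blast
  show "preimage_trunks X Y f \<subseteq> trunks X"
    using assms by (simp add: morphism_iff_preimage_trunks)
  obtain g where g: "morphism Y X g" "g ` snd Y = snd X"
    using assms(3) by (auto simp: isomorphic_def isomorphism_def bij_betw_def)
  have "card (trunks X) = card (preimage_trunks Y X g)"
    using card_preimage_trunks[OF g(2)] by simp
  also have "\<dots> \<le> card (trunks Y)"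
    using g by (intro card_mono finite_trunks assms) (simp add: morphism_iff_preimage_trunks)
  also have "\<dots> = card (preimage_trunks X Y f)"
    using card_preimage_trunks[OF assms(5)] by simp
  finally show "card (trunks X) \<le> card (preimage_trunks X Y f)" .
qed

section \<open>Codes determined by lists of trunks\<close>

definition determined_code :: "nat set set \<Rightarrow> nat set set list \<Rightarrow> code" where
  "determined_code C Ss = (length Ss, determined_morphism Ss ` C)"

lemma determined_code_in_codes: "determined_code C Ss \<in> codes"
  by (auto simp: determined_code_def codes_def determined_morphism_def)

lemma preimage_Tk_determined:
  assumes "\<tau> \<subseteq> {1..length Ss}"
  shows "{c \<in> C. determined_morphism Ss c \<in> Tk (determined_morphism Ss ` C) \<tau>} =
    {c \<in> C. \<forall>j \<in> \<tau>. c \<in> Ss ! (j - 1)}"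
  using assms by (auto simp: Tk_def determined_morphism_def)

text \<open>Forgets list positions: a trunk of the determined code prescribes coordinates, so it
  pulls back to an intersection of listed sets. An empty \<T> gives all of \<open>C\<close>.\<close>

lemma preimage_trunks_determinedE:
  assumes "S \<in> preimage_trunks (n, C) (determined_code C Ss) (determined_morphism Ss)"
  obtains "S = {}"
  | \<T> where "\<T> \<subseteq> set Ss" "S = {c \<in> C. \<forall>T \<in> \<T>. c \<in> T}"
proof -
  obtain R where R: "R \<in> trunks (determined_code C Ss)"
    "S = {c \<in> C. determined_morphism Ss c \<in> R}"
    using assms by (auto simp: preimage_trunks_def)
  from R(1) show ?thesis
    unfolding determined_code_def
  proof (cases rule: trunks_cases)
    case 1
    thus ?thesis using R(2) that by simp
  next
    case (2 \<tau>)
    show ?thesis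
    proof (rule that(2))
      show "(\<lambda>j. Ss ! (j - 1)) ` \<tau> \<subseteq> set Ss"
        using 2(1) by (force intro!: nth_mem)
      show "S = {c \<in> C. \<forall>T \<in> (\<lambda>j. Ss ! (j - 1)) ` \<tau>. c \<in> T}"
        using R(2) 2 preimage_Tk_determined[OF 2(1)] by simp
    qed
  qed
qed

lemma in_preimage_trunks_determined:
  assumes "T \<in> set Ss" "T \<subseteq> C"
  shows "T \<in> preimage_trunks (n, C) (determined_code C Ss) (determined_morphism Ss)"
proof -
  obtain k where k: "k < length Ss" "T = Ss ! k"
    using assms(1) by (auto simp: in_set_conv_nth)
  \<comment> \<open>Neuron \<open>Suc k\<close> corresponds to list position
    \<open>k\<close>.\<close>
  have "{c \<in> C. determined_morphism Ss c \<in> Tk (determined_morphism Ss ` C) {Suc k}} = T"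
    using preimage_Tk_determined[of "{Suc k}" Ss C] k assms(2) by auto
  thus ?thesis
    using preimage_trunksI[OF Tk_in_trunks[of "{Suc k}"], of "length Ss" "(n, C)"
        "determined_morphism Ss" "determined_morphism Ss ` C"] k
    by (simp add: determined_code_def)
qed

lemma morphism_determined:
  assumes "set Ss \<subseteq> trunks (n, C)"
  shows "morphism (n, C) (determined_code C Ss) (determined_morphism Ss)"
  unfolding morphism_iff_preimage_trunks
proof (intro conjI subsetI)
  fix S assume "S \<in> preimage_trunks (n, C) (determined_code C Ss) (determined_morphism Ss)"
  thus "S \<in> trunks (n, C)"
  proof (cases rule: preimage_trunks_determinedE)
    case 1
    thus ?thesis by (simp add: empty_in_trunks)
  next
    case (2 \<T>)
    have "finite \<T>" using 2(1) finite_subset by blast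
    thus ?thesis
      unfolding 2(2) using 2(1) assms whole_in_trunks[of "(n, C)"]
      by (intro finite_Inter_in_family) (auto intro: Int_in_trunks)
  qed
qed (auto simp: determined_code_def)

section \<open>The covered code and the trunks it realises\<close>

lemma covered_code_conv_determined:
  "covered_code n C i = determined_code C (covered_code_trunks n C i)"
  by (simp add: covered_code_def determined_code_def)

lemma set_covered_code_trunks:
  "set (covered_code_trunks n C i) =
     {simple_trunk C j | j. j \<in> {1..n} \<and> j \<noteq> i} \<union>
     {simple_trunk C j \<inter> simple_trunk C i | j. j \<in> {1..n} \<and> j \<noteq> i \<and>
        simple_trunk C j \<inter> simple_trunk C i \<noteq> simple_trunk C i}"
  by (auto simp: covered_code_trunks_def)

lemma covered_code_trunks_in_trunks:
  assumes "i \<in> {1..n}"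
  shows "set (covered_code_trunks n C i) \<subseteq> trunks (n, C)"
proof
  fix S assume "S \<in> set (covered_code_trunks n C i)"
  then obtain j where "j \<in> {1..n}"
    "S = simple_trunk C j \<or> S = simple_trunk C j \<inter> simple_trunk C i"
    unfolding set_covered_code_trunks by blast
  thus "S \<in> trunks (n, C)"
    using simple_trunk_in_trunks[of j n C] Int_in_trunks simple_trunk_in_trunks[OF assms] by metis
qed

text \<open>If \<open>i\<close> is not in \<sigma>, the trunk is an intersection of listed simple
  trunks. Otherwise it is an intersection of listed sets
  \<open>simple_trunk C j \<inter> simple_trunk C i\<close>.\<close>

lemma trunk_in_preimage_trunks_covered:
  assumes "i \<in> {1..n}" "S \<in> trunks (n, C)" "S \<noteq> simple_trunk C i"
  shows "S \<in> preimage_trunks (n, C) (covered_code n C i)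
    (determined_morphism (covered_code_trunks n C i))" (is "_ \<in> ?F")
proof -
  let ?T = "simple_trunk C"
  have gen: "T \<in> ?F" if "T \<in> set (covered_code_trunks n C i)" for T
    unfolding covered_code_conv_determined
    using that covered_code_trunks_in_trunks[OF assms(1)] trunks_subset[of T "(n, C)"]
    by (intro in_preimage_trunks_determined) auto
  have whole: "C \<in> ?F"
    using whole_in_preimage_trunks[of _ "(n, C)"] by (simp add: covered_code_def)
  from assms(2) show ?thesis
  proof (cases rule: trunks_cases)
    case 1
    thus ?thesis by (simp add: empty_in_preimage_trunks)
  next
    case (2 \<sigma>)
    have fin: "finite \<sigma>" using 2(1) finite_subset by blast
    show ?thesis
    proof (cases "i \<in> \<sigma>")
      case False
      show ?thesis
        unfolding 2(2) Tk_conv_simple_trunks[of C \<sigma>]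
      proof (rule finite_Inter_in_family[OF whole Int_in_preimage_trunks])
        show "finite \<sigma>" by (rule fin)
        fix j assume "j \<in> \<sigma>"
        hence "?T j \<in> set (covered_code_trunks n C i)"
          unfolding set_covered_code_trunks using False 2(1) by blast
        thus "?T j \<in> ?F" by (rule gen)
      qed
    next
      case True
      \<comment> \<open>Neurons whose trunk contains \<open>?T i\<close> impose no further condition
        and are dropped. If none remained, \<open>S\<close> would be \<open>?T i\<close>; one
        survivor is enough to keep the intersection inside \<open>?T i\<close>.\<close>
      define \<rho> where "\<rho> = {j \<in> \<sigma>. j \<noteq> i \<and> ?T j \<inter> ?T i \<noteq> ?T i}"
      have "\<rho> \<noteq> {}"
        using 2(2) assms(3) True by (auto simp: \<rho>_def Tk_def)
      hence "S = {c \<in> C. \<forall>j \<in> \<rho>. c \<in> ?T j \<inter> ?T i}"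
        using 2(2) True by (auto simp: \<rho>_def Tk_def)
      also have "\<dots> \<in> ?F"
      proof (rule finite_Inter_in_family[OF whole Int_in_preimage_trunks])
        show "finite \<rho>" using fin by (simp add: \<rho>_def)
        fix j assume "j \<in> \<rho>"
        hence "?T j \<inter> ?T i \<in> set (covered_code_trunks n C i)"
          unfolding set_covered_code_trunks \<rho>_def using 2(1) by blast
        thus "?T j \<inter> ?T i \<in> ?F" by (rule gen)
      qed
      finally show ?thesis .
    qed
  qed
qed

text \<open>Every set in an intersection equal to \<open>simple_trunk C i\<close> must contain it.
  The listed pairwise intersections are proper subsets of it, so only simple trunks of other neurons
  can occur.\<close>

lemma simple_trunk_in_preimage_trunks_coveredE:
  assumes "simple_trunk C i \<in> preimage_trunks (n, C) (covered_code n C i)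
    (determined_morphism (covered_code_trunks n C i))" "simple_trunk C i \<noteq> {}"
  obtains \<sigma> where "\<sigma> \<subseteq> {1..n} - {i}" "simple_trunk C i = Tk C \<sigma>"
  using assms(1) unfolding covered_code_conv_determined
proof (cases rule: preimage_trunks_determinedE)
  case 1
  thus ?thesis using assms(2) by simp
next
  case (2 \<T>)
  define \<sigma> where "\<sigma> = {j \<in> {1..n} - {i}. simple_trunk C j \<in> \<T>}"
  have "\<T> \<subseteq> {simple_trunk C j | j. j \<in> {1..n} \<and> j \<noteq> i}"
    using 2 unfolding set_covered_code_trunks by blast
  hence "\<T> = simple_trunk C ` \<sigma>" by (auto simp: \<sigma>_def)
  hence "simple_trunk C i = Tk C \<sigma>"
    using 2(2) unfolding Tk_conv_simple_trunks[of C \<sigma>] by auto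
  moreover have "\<sigma> \<subseteq> {1..n} - {i}" unfolding \<sigma>_def by blast
  ultimately show ?thesis using that by blast
qed

section \<open>Covers arising from proper trunks and from morphisms on the whole code\<close>

text \<open>The third assumption excludes repeated nonempty simple trunks: omitting one of two equal
  trunks loses nothing, and the covered code is then isomorphic to \<open>C\<close>. The fourth
  excludes the empty code below \<open>{{1..n}}\<close>, whose simple trunks and covered codes all
  have exactly one codeword.\<close>

theorem theorem3p21:
  fixes n m :: nat and C D :: "nat set set"
  assumes "(n, C) \<in> codes" and "(m, D) \<in> codes"
    and "\<forall>i \<in> {1..n}. \<forall>j \<in> {1..n}. i \<noteq> j \<and> simple_trunk C i = simple_trunk C j
           \<longrightarrow> simple_trunk C i = {}"
    and "\<not> (C = {{1..n}} \<and> D = {})"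
    and "P_Code_covers (iso_class (n, C)) (iso_class (m, D))"
  shows "(\<exists>j \<in> {1..n}. isomorphic (m, D) (n, simple_trunk C j)) \<or>
         (\<exists>i \<in> {1..n}. isomorphic (m, D) (covered_code n C i))"
proof -
  have "P_Code_le (iso_class (m, D)) (iso_class (n, C))"
    and niso: "\<not> isomorphic (m, D) (n, C)"
    using assms(5) iso_class_eq_iff[OF assms(2,1)] by (auto simp: P_Code_covers_def P_Code_less_def)
  then obtain S f where S: "S \<in> trunks (n, C)" and f: "morphism (n, S) (m, D) f" "f ` S = D"
    using P_Code_le_trunk_image[OF assms(1,2)] by auto
  have finC: "finite C" using assms(1) by (rule finite_codeword_set)
  show ?thesis
  proof (cases "S = C")
    case False
    have "\<exists>j \<in> {1..n}. S \<subseteq> simple_trunk C j \<and> simple_trunk C j \<noteq> C"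
    proof (rule ccontr)
      assume "\<not> ?thesis"
      hence *: "simple_trunk C j = C" if "j \<in> {1..n}" "S \<subseteq> simple_trunk C j" for j
        using that by blast
      from S show False
      proof (cases rule: trunks_cases)
        case 1
        \<comment> \<open>The empty trunk lies in every simple trunk, so all of these equal
          \<open>C\<close> and only the full codeword is possible. Then \<open>D\<close>, the image
          of the empty set, is empty: the excluded case.\<close>
        have "{1..n} \<subseteq> c" if "c \<in> C" for c
        proof
          fix j assume "j \<in> {1..n}"
          hence "c \<in> simple_trunk C j" using * 1 that by simp
          thus "j \<in> c" by (simp add: Tk_def)
        qed
        hence "C \<subseteq> {{1..n}}"
          using assms(1) by (auto simp: codes_def)
        thus False using 1 False f assms(4) by auto
      next
        case (2 \<sigma>)
        hence "simple_trunk C j = C" if "j \<in> \<sigma>" for j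
          using that by (intro *) (auto simp: Tk_def)
        hence "S = C" using 2(2) unfolding Tk_conv_simple_trunks[of C \<sigma>] by auto
        thus False using False by blast
      qed
    qed
    then obtain j where j: "j \<in> {1..n}" "S \<subseteq> simple_trunk C j" "simple_trunk C j \<noteq> C" by blast
    let ?T = "simple_trunk C j"
    have T: "?T \<in> trunks (n, C)" using j by (intro simple_trunk_in_trunks)
    have Tcodes: "(n, ?T) \<in> codes" by (rule trunk_in_codes[OF assms(1) T])
    have "?T \<subset> C" using j(3) by (auto simp: Tk_def)
    hence "card ?T < card C" by (rule psubset_card_mono[OF finC])
    hence "\<not> isomorphic (n, ?T) (n, C)"
      using isomorphic_card_eq[of "(n, ?T)" "(n, C)"] by (metis less_irrefl snd_conv)
    moreover have "S \<in> trunks (n, ?T)"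
      using Int_trunk_in_trunks[OF S, of ?T] j(2) \<open>?T \<subset> C\<close> by (simp add: Int_absorb2)
    hence "P_Code_le (iso_class (m, D)) (iso_class (n, ?T))"
      unfolding P_Code_le_trunk_image[OF Tcodes assms(2)] using f by (metis snd_conv)
    moreover have "P_Code_le (iso_class (n, ?T)) (iso_class (n, C))"
      unfolding P_Code_le_trunk_image[OF assms(1) Tcodes]
      using T morphism_id[of "(n, ?T)"] image_id by (metis id_apply snd_conv)
    ultimately have "isomorphic (m, D) (n, ?T)"
      by (intro P_Code_covers_sandwich[OF assms(5,1,2) Tcodes])
    thus ?thesis using j(1) by blast
  next
    case True
    let ?F = "preimage_trunks (n, C) (m, D) f"
    define N where "N = {i \<in> {1..n}. simple_trunk C i \<notin> ?F}"
    have "\<not> trunks (n, C) \<subseteq> ?F"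
      using isomorphic_if_trunks_preimages[OF assms(1), of "(m, D)" f] f True niso isomorphic_sym
      by auto
    hence "N \<noteq> {}"
      using trunks_in_preimage_trunks[of f C "(m, D)" n] f True by (auto simp: N_def)
    moreover have "finite N" by (simp add: N_def)
    ultimately obtain i where i: "i \<in> N"
      and max: "\<And>j. j \<in> N \<Longrightarrow> simple_trunk C i \<subseteq> simple_trunk C j \<Longrightarrow>
        simple_trunk C i = simple_trunk C j"
      using finite_has_maximal[of "simple_trunk C ` N"] by auto
    let ?T = "simple_trunk C i" and ?E = "covered_code n C i"
    let ?g = "determined_morphism (covered_code_trunks n C i)"
    let ?G = "preimage_trunks (n, C) ?E ?g"
    have i': "i \<in> {1..n}" "?T \<notin> ?F" using i by (auto simp: N_def)
    hence ne: "?T \<noteq> {}" using empty_in_preimage_trunks by metis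
    have Ecodes: "?E \<in> codes"
      by (simp add: covered_code_conv_determined determined_code_in_codes)
    have g: "morphism (n, C) ?E ?g" "?g ` snd (n, C) = snd ?E"
      unfolding covered_code_conv_determined
      using morphism_determined[OF covered_code_trunks_in_trunks[OF i'(1)]]
      by (simp_all add: determined_code_def)
    \<comment> \<open>Strictness is seen on trunks because codeword counts may agree: for
      \<open>n = 2\<close>, \<open>C = {{1}, {2}}\<close> and \<open>i = 1\<close> the map
      \<open>?g\<close> is injective on \<open>C\<close>.\<close>
    have "?T \<notin> ?G"
    proof
      assume "?T \<in> ?G"
      then obtain \<sigma> where \<sigma>: "\<sigma> \<subseteq> {1..n} - {i}" "?T = Tk C \<sigma>"
        using simple_trunk_in_preimage_trunks_coveredE ne by metis
      have "simple_trunk C j \<in> ?F" if "j \<in> \<sigma>" for j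
      proof (rule ccontr)
        assume "simple_trunk C j \<notin> ?F"
        hence "j \<in> N" using that \<sigma>(1) by (auto simp: N_def)
        moreover have "?T \<subseteq> simple_trunk C j" using \<sigma>(2) that by (auto simp: Tk_def)
        ultimately have "?T = simple_trunk C j" by (rule max)
        \<comment> \<open>Maximality gives equality of trunks only; the third assumption turns this
          into equality of neurons, but \<open>i\<close> is not in \<sigma>.\<close>
        thus False using assms(3) i'(1) ne \<sigma>(1) that by blast
      qed
      moreover have "finite \<sigma>" using \<sigma>(1) finite_subset by blast
      moreover have "C \<in> ?F" using whole_in_preimage_trunks[of f "(n, C)" "(m, D)"] f True by simp
      ultimately have "?T \<in> ?F"
        unfolding \<sigma>(2) Tk_conv_simple_trunks[of C \<sigma>]
        by (intro finite_Inter_in_family) (auto intro: Int_in_preimage_trunks)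
      thus False using i'(2) by blast
    qed
    hence "\<not> isomorphic ?E (n, C)"
      using isomorphic_imp_trunks_eq_preimages[OF assms(1) Ecodes _ g]
        simple_trunk_in_trunks[OF i'(1)] by metis
    moreover have "P_Code_le (iso_class ?E) (iso_class (n, C))"
      by (rule P_Code_le_image[OF assms(1) Ecodes g])
    moreover have "P_Code_le (iso_class (m, D)) (iso_class ?E)"
    proof -
      have fC: "morphism (n, C) (m, D) f" using f True by simp
      \<comment> \<open>\<open>?F\<close> consists of trunks of \<open>C\<close> and misses
        \<open>?T\<close>, while \<open>?G\<close> contains every trunk other than
        \<open>?T\<close>.\<close>
      hence "?F \<subseteq> ?G"
        using trunk_in_preimage_trunks_covered[OF i'(1)] i'(2)
        unfolding morphism_iff_preimage_trunks by blast
      then obtain h where h: "morphism ?E (m, D) h" "\<And>c. c \<in> C \<Longrightarrow> h (?g c) = f c"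
        using morphism_factor[OF assms(2) fC g] by auto
      have "h ` snd ?E = D" using h(2) f True g(2)[symmetric] by (auto simp: image_image)
      thus ?thesis by (intro P_Code_le_image[OF Ecodes assms(2) h(1)]) simp
    qed
    ultimately have "isomorphic (m, D) ?E"
      by (intro P_Code_covers_sandwich[OF assms(5,1,2) Ecodes])
    thus ?thesis using i'(1) by blast
  qed
qed

end
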